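(* Fix $k\in\mathbb Z_{\ge0}$. Let $(P,Q,R)$ be a $k$-GC triple whose $(1,2)$-entries $(a,b,c)=(p_{12},q_{12},r_{12})$ satisfy $b>\max\{a,c\}$. Then $(P,Q,R)$ has an MM decomposition, and it is unique up to sign: if $(X_1,Y_1,Z_1)$ and $(X_2,Y_2,Z_2)$ are MM decompositions of $(P,Q,R)$, then $(X_1,Y_1,Z_1)=\pm(X_2,Y_2,Z_2)$.
   Context: Fix $k\in\mathbb Z_{\ge0}$. A $k$-GM triple is $(a,b,c)\in\mathbb Z_{\ge1}^3$ with $a^2+b^2+c^2+k(bc+ca+ab)=(3+3k)abc$; a $k$-GM number is an entry of some $k$-GM triple. Let $S=\begin{bmatrix}k&0\\3k^2+3k&k\end{bmatrix}$. A $k$-GC matrix is $P\in SL(2,\mathbb Z)$ whose $(1,2)$-entry $p_{12}$ is a $k$-GM number and $\operatorname{tr}P=(3k+3)p_{12}-k$; a $k$-GC triple is a triple $(P,Q,R)$ of $k$-GC matrices with $Q=PR-S$ and $(p_{12},q_{12},r_{12})$ a $k$-GM triple. An MM decomposition of a $k$-GC triple $(P,Q,R)$ is a triple $(X,Y,Z)$ with $X,Y,Z\in SL(2,\mathbb Z)$, $P=-Z^{-1}Y^{-1}$, $Q=-Z^{-1}X^{-1}$, $R=-Y^{-1}X^{-1}$, and $\operatorname{tr}X=\operatorname{tr}Y=\operatorname{tr}Z$. *)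

theory Defs
  imports "HOL-Analysis.Analysis"
begin

definition GM_triple :: "int \<Rightarrow> int \<Rightarrow> int \<Rightarrow> int \<Rightarrow> bool" where
  "GM_triple k a b c \<longleftrightarrow> a \<ge> 1 \<and> b \<ge> 1 \<and> c \<ge> 1 \<and>
     a\<^sup>2 + b\<^sup>2 + c\<^sup>2 + k * (b * c + c * a + a * b) = (3 + 3 * k) * a * b * c"

definition GM_number :: "int \<Rightarrow> int \<Rightarrow> bool" where
  "GM_number k n \<longleftrightarrow> (\<exists>a b c. GM_triple k a b c \<and> n \<in> {a, b, c})"

definition SL2Z :: "(int^2^2) set" where
  "SL2Z = {A. det A = 1}"

definition S_mat :: "int \<Rightarrow> int^2^2" where
  "S_mat k = vector [vector [k, 0], vector [3 * k\<^sup>2 + 3 * k, k]]"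

definition GC_matrix :: "int \<Rightarrow> int^2^2 \<Rightarrow> bool" where
  "GC_matrix k P \<longleftrightarrow> P \<in> SL2Z \<and> GM_number k (P $ 1 $ 2) \<and>
     trace P = (3 * k + 3) * (P $ 1 $ 2) - k"

definition GC_triple :: "int \<Rightarrow> int^2^2 \<Rightarrow> int^2^2 \<Rightarrow> int^2^2 \<Rightarrow> bool" where
  "GC_triple k P Q R \<longleftrightarrow> GC_matrix k P \<and> GC_matrix k Q \<and> GC_matrix k R \<and>
     Q = P ** R - S_mat k \<and> GM_triple k (P $ 1 $ 2) (Q $ 1 $ 2) (R $ 1 $ 2)"

(* For a matrix in SL2Z, matrix_inv over int is the genuine two-sided integral inverse. *)
definition MM_decomposition ::
  "int^2^2 \<Rightarrow> int^2^2 \<Rightarrow> int^2^2 \<Rightarrow> int^2^2 \<Rightarrow> int^2^2 \<Rightarrow> int^2^2 \<Rightarrow> bool" where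
  "MM_decomposition P Q R X Y Z \<longleftrightarrow> X \<in> SL2Z \<and> Y \<in> SL2Z \<and> Z \<in> SL2Z \<and>
     P = - (matrix_inv Z ** matrix_inv Y) \<and>
     Q = - (matrix_inv Z ** matrix_inv X) \<and>
     R = - (matrix_inv Y ** matrix_inv X) \<and>
     trace X = trace Y \<and> trace Y = trace Z"

end

theory Submission
  imports Defs
begin

text \<open>
  Write \<open>S = k T\<close> with \<open>T\<close> unimodular. The trace conditions on \<open>P\<close>, \<open>Q\<close>, \<open>R\<close> say that
  \<open>P T\<^sup>-\<^sup>1\<close>, \<open>Q T\<^sup>-\<^sup>1\<close>, \<open>R T\<^sup>-\<^sup>1\<close> have trace \<open>-k\<close>, so Cayley--Hamilton shows that
  \<open>X = - T\<^sup>-\<^sup>1 P\<close>, \<open>Y = P\<^sup>-\<^sup>1 T R\<^sup>-\<^sup>1\<close>, \<open>Z = - R T\<^sup>-\<^sup>1\<close> is a decomposition, all traces being \<open>k\<close>.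

  For uniqueness, \<open>X\<close> and \<open>Z\<close> are determined by \<open>Y\<close>, and every decomposition satisfies
  \<open>P\<^sup>-\<^sup>1 S R\<^sup>-\<^sup>1 = 1 + Y\<^sup>2 = (tr Y) Y\<close>. Determinants give \<open>(tr Y)\<^sup>2 = k\<^sup>2\<close>, so \<open>Y\<close> is unique up to
  sign if \<open>k \<noteq> 0\<close>. If \<open>k = 0\<close>, then \<open>Y\<close>, \<open>P Y\<close> and \<open>Y R\<close> have trace zero; these linear equations
  determine \<open>Y\<close> up to a scalar because \<open>1, P, R\<close> are linearly independent by the Markov equation,
  and \<open>det Y = 1\<close> fixes the scalar up to sign.
\<close>

section \<open>Adjugates of 2 by 2 integer matrices\<close>

definition adj2 :: "int^2^2 \<Rightarrow> int^2^2" where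
  "adj2 A = vector [vector [A $ 2 $ 2, - (A $ 1 $ 2)], vector [- (A $ 2 $ 1), A $ 1 $ 1]]"

lemmas mat2_simps = vec_eq_iff forall_2 matrix_matrix_mult_def sum_2 mat_def adj2_def
  S_mat_def det_2 trace_def

lemma adj2_adj2 [simp]: "adj2 (adj2 A) = A"
  by (simp add: mat2_simps)

lemma adj2_uminus [simp]: "adj2 (- A) = - adj2 A"
  by (simp add: mat2_simps)

lemma adj2_mult: "adj2 (A ** B) = adj2 B ** adj2 A"
  by (simp add: mat2_simps algebra_simps)

lemma det_adj2 [simp]: "det (adj2 A) = det A"
  by (simp add: mat2_simps algebra_simps)

lemma trace_adj2 [simp]: "trace (adj2 A) = trace A"
  by (simp add: mat2_simps)

lemma det_uminus2 [simp]: "det (- A) = det (A :: int^2^2)"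
  by (simp add: mat2_simps)

lemma mult_minus_left2 [simp]: "(- A) ** B = - (A ** B)" for A B :: "int^2^2"
  by (simp add: mat2_simps)

lemma mult_minus_right2 [simp]: "A ** (- B) = - (A ** B)" for A B :: "int^2^2"
  by (simp add: mat2_simps)

lemma mult_adj2:
  assumes "det A = 1"
  shows "A ** adj2 A = mat 1" "adj2 A ** A = mat 1"
  using assms by (auto simp: mat2_simps algebra_simps)

lemma mult_adj2_cancel:
  assumes "det A = 1"
  shows "A ** (adj2 A ** B) = B" "adj2 A ** (A ** B) = B"
    "C ** A ** adj2 A = C" "C ** adj2 A ** A = C"
  by (simp_all add: matrix_mul_assoc mult_adj2[OF assms])
    (simp_all add: matrix_mul_assoc[symmetric] mult_adj2[OF assms])

text \<open>Replaces the inverse, defined by choice, with a formula in the entries.\<close>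

lemma matrix_inv_eq_adj2:
  assumes "det A = 1"
  shows "matrix_inv A = adj2 A"
proof -
  have "A ** matrix_inv A = mat 1 \<and> matrix_inv A ** A = mat 1"
    unfolding matrix_inv_def by (rule someI[of _ "adj2 A"]) (simp add: mult_adj2[OF assms])
  then have "adj2 A ** (A ** matrix_inv A) = adj2 A"
    by simp
  then show ?thesis
    by (simp add: mult_adj2_cancel[OF assms])
qed

lemma cayley_hamilton2:
  fixes A :: "int^2^2"
  assumes "det A = 1"
  shows "mat 1 + A ** A = mat (trace A) ** A"
  using assms by (auto simp: mat2_simps algebra_simps)

lemma MM_decomposition_iff:
  "MM_decomposition P Q R X Y Z \<longleftrightarrow> det X = 1 \<and> det Y = 1 \<and> det Z = 1 \<and>
     P = - (adj2 Z ** adj2 Y) \<and> Q = - (adj2 Z ** adj2 X) \<and> R = - (adj2 Y ** adj2 X) \<and>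
     trace X = trace Y \<and> trace Y = trace Z"
  unfolding MM_decomposition_def SL2Z_def by (auto simp: matrix_inv_eq_adj2)

text \<open>\<open>S_mat k\<close> is \<open>k\<close> times the following unimodular matrix.\<close>

definition T_mat :: "int \<Rightarrow> int^2^2" where
  "T_mat k = vector [vector [1, 0], vector [3 * k + 3, 1]]"

lemma det_T_mat [simp]: "det (T_mat k) = 1"
  by (simp add: T_mat_def det_2)

lemma trace_mult_adj2_T_mat:
  "trace (A ** adj2 (T_mat k)) = trace A - (3 * k + 3) * A $ 1 $ 2"
  by (simp add: T_mat_def mat2_simps algebra_simps)

section \<open>Existence of a decomposition\<close>

lemma MM_decomposition_exists:
  assumes "det P = 1" "det R = 1"
    and Q: "Q = P ** R - S_mat k"
    and trP: "trace P = (3 * k + 3) * P $ 1 $ 2 - k"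
    and trQ: "trace Q = (3 * k + 3) * Q $ 1 $ 2 - k"
    and trR: "trace R = (3 * k + 3) * R $ 1 $ 2 - k"
  shows "MM_decomposition P Q R (- (adj2 (T_mat k) ** P))
    (adj2 P ** T_mat k ** adj2 R) (- (R ** adj2 (T_mat k)))"
proof -
  let ?T = "T_mat k"
  have PR: "P ** R = Q + S_mat k"
    using Q by simp
  have q: "Q $ 1 $ 1 = (3 * k + 3) * Q $ 1 $ 2 - k - Q $ 2 $ 2"
    using trQ by (simp add: trace_def sum_2)
  \<comment> \<open>Let \<open>M = P ** R ** adj2 ?T\<close>. Since \<open>S_mat k\<close> is
    \<open>k\<close> times \<open>?T\<close>, the trace of \<open>M\<close> is -k + 2k = k, and
    Cayley-Hamilton turns (M - k) T, which is \<open>Q\<close>, into -adj(M) T.\<close>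
  have Q': "Q = - (?T ** adj2 (P ** R) ** ?T)"
    unfolding PR by (simp add: mat2_simps T_mat_def q algebra_simps power2_eq_square)
  have tr_uminus: "trace (- A) = - trace A" for A :: "int^2^2"
    by (simp add: trace_def sum_2)
  have "trace (- (adj2 ?T ** P)) = k"
    by (simp add: tr_uminus trace_mul_sym[of "adj2 ?T"] trace_mult_adj2_T_mat trP)
  moreover have "trace (- (R ** adj2 ?T)) = k"
    by (simp add: tr_uminus trace_mult_adj2_T_mat trR)
  moreover have "trace (adj2 P ** ?T ** adj2 R) = k"
  proof -
    \<comment> \<open>Adjugation keeps the trace and, up to cyclic order, yields the matrix
      \<open>M\<close> above.\<close>
    have "trace (adj2 P ** ?T ** adj2 R) = trace (adj2 (adj2 P ** ?T ** adj2 R))"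
      by simp
    also have "\<dots> = trace (R ** adj2 ?T ** P)"
      by (simp add: adj2_mult matrix_mul_assoc)
    also have "\<dots> = trace (P ** R ** adj2 ?T)"
      by (metis trace_mul_sym matrix_mul_assoc)
    also have "\<dots> = k"
      unfolding PR trace_mult_adj2_T_mat using trQ by (simp add: trace_def sum_2 S_mat_def)
    finally show ?thesis .
  qed
  ultimately show ?thesis
    unfolding MM_decomposition_iff using assms(1,2) Q'
    by (simp add: det_mul adj2_mult matrix_mul_assoc mult_adj2_cancel mult_adj2)
qed

section \<open>Constraints on the middle matrix\<close>

lemma MM_decomposition_determined_by_middle:
  assumes "MM_decomposition P Q R X Y Z"
  shows "X = - (adj2 R ** adj2 Y)" "Z = - (adj2 Y ** adj2 P)"
  using assms unfolding MM_decomposition_iff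
  by (auto simp: adj2_mult mult_adj2_cancel)

text \<open>In \<open>adj2 P ** Q ** adj2 R\<close> the factors \<open>Z\<close> and
  \<open>X\<close> cancel against their inverses, leaving \<open>- (Y ** Y)\<close>.\<close>

lemma MM_decomposition_middle:
  assumes "MM_decomposition P Q R X Y Z"
  shows "adj2 P ** (P ** R - Q) ** adj2 R = mat (trace Y) ** Y"
proof -
  have d: "det X = 1" "det Y = 1" "det Z = 1"
    and P: "P = - (adj2 Z ** adj2 Y)" and Q: "Q = - (adj2 Z ** adj2 X)"
    and R: "R = - (adj2 Y ** adj2 X)"
    using assms unfolding MM_decomposition_iff by auto
  have dP: "det P = 1" and dR: "det R = 1"
    by (simp_all add: P R det_mul d)
  have diff2: "A ** (B - C) ** D = A ** B ** D - A ** C ** D" for A B C D :: "int^2^2"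
    by (simp add: mat2_simps algebra_simps)
  have "adj2 P ** Q ** adj2 R = - (Y ** Y)"
    by (simp add: P Q R adj2_mult matrix_mul_assoc mult_adj2_cancel d)
  then have "adj2 P ** (P ** R - Q) ** adj2 R = mat 1 + Y ** Y"
    unfolding diff2 by (simp add: matrix_mul_assoc mult_adj2 mult_adj2_cancel dP dR)
  then show ?thesis
    by (simp add: cayley_hamilton2 d)
qed

lemma MM_decomposition_trace_sq:
  assumes "MM_decomposition P Q R X Y Z" "det P = 1" "det R = 1" "Q = P ** R - S_mat k"
  shows "(trace Y)\<^sup>2 = k\<^sup>2"
proof -
  have "det (adj2 P ** S_mat k ** adj2 R) = det (mat (trace Y) ** Y)"
    using MM_decomposition_middle[OF assms(1)] assms(4) by simp
  moreover have "det Y = 1"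
    using assms(1) by (simp add: MM_decomposition_iff)
  moreover have "det (S_mat k) = k\<^sup>2" "det (mat t :: int^2^2) = t\<^sup>2" for t
    by (simp_all add: det_2 S_mat_def mat_def power2_eq_square)
  ultimately show ?thesis
    by (simp add: det_mul assms)
qed

lemma mat_mult2: "(mat t ** A) $ i $ j = t * (A :: int^2^2) $ i $ j"
  using exhaust_2[of i] exhaust_2[of j] by (auto simp: mat2_simps)

section \<open>Uniqueness for k = 0\<close>

text \<open>
  The failure of both inequalities would make the traceless parts of \<open>P\<close> and \<open>R\<close> proportional;
  comparing discriminants then gives \<open>P = R\<close>, which the Markov equation excludes.
\<close>

lemma markov_pair_independent:
  fixes P R :: "int^2^2"
  assumes "det P = 1" "det R = 1"
    and trP: "trace P = 3 * P $ 1 $ 2" and trR: "trace R = 3 * R $ 1 $ 2"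
    and GM: "GM_triple 0 (P $ 1 $ 2) ((P ** R) $ 1 $ 2) (R $ 1 $ 2)"
  shows "(P $ 1 $ 1 - P $ 2 $ 2) * R $ 1 $ 2 \<noteq> (R $ 1 $ 1 - R $ 2 $ 2) * P $ 1 $ 2 \<or>
    P $ 2 $ 1 * R $ 1 $ 2 \<noteq> R $ 2 $ 1 * P $ 1 $ 2"
proof (rule ccontr)
  assume "\<not> ?thesis"
  then have 1: "(P $ 1 $ 1 - P $ 2 $ 2) * R $ 1 $ 2 = (R $ 1 $ 1 - R $ 2 $ 2) * P $ 1 $ 2"
    and 2: "P $ 2 $ 1 * R $ 1 $ 2 = R $ 2 $ 1 * P $ 1 $ 2" by auto
  have disc: "(A $ 1 $ 1 - A $ 2 $ 2)\<^sup>2 + 4 * (A $ 1 $ 2 * A $ 2 $ 1) = (trace A)\<^sup>2 - 4 * det A"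
    for A :: "int^2^2"
    by (simp add: mat2_simps algebra_simps power2_eq_square)
  have pos: "P $ 1 $ 2 \<ge> 1" "R $ 1 $ 2 \<ge> 1"
    using GM by (auto simp: GM_triple_def)
  have "(R $ 1 $ 2)\<^sup>2 * ((P $ 1 $ 1 - P $ 2 $ 2)\<^sup>2 + 4 * (P $ 1 $ 2 * P $ 2 $ 1)) =
    ((P $ 1 $ 1 - P $ 2 $ 2) * R $ 1 $ 2)\<^sup>2 + 4 * P $ 1 $ 2 * R $ 1 $ 2 * (P $ 2 $ 1 * R $ 1 $ 2)"
    by algebra
  also have "\<dots> = (P $ 1 $ 2)\<^sup>2 * ((R $ 1 $ 1 - R $ 2 $ 2)\<^sup>2 + 4 * (R $ 1 $ 2 * R $ 2 $ 1))"
    unfolding 1 2 by algebra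
  \<comment> \<open>With a, c the upper right entries, the discriminants are 9a^2 - 4 and 9c^2 - 4,
    so c^2 (9a^2 - 4) = a^2 (9c^2 - 4).\<close>
  finally have "(R $ 1 $ 2)\<^sup>2 = (P $ 1 $ 2)\<^sup>2"
    unfolding disc trP trR assms(1,2) by (simp add: algebra_simps)
  with pos have c: "R $ 1 $ 2 = P $ 1 $ 2"
    by (simp add: power2_eq_iff)
  with 1 2 pos have "R $ 1 $ 1 - R $ 2 $ 2 = P $ 1 $ 1 - P $ 2 $ 2"
    by simp
  moreover have "R $ 1 $ 1 + R $ 2 $ 2 = P $ 1 $ 1 + P $ 2 $ 2"
    using trP trR c by (simp add: trace_def sum_2)
  ultimately have d: "R $ 2 $ 2 = P $ 2 $ 2"
    by simp
  have b: "(P ** R) $ 1 $ 2 = 3 * P $ 1 $ 2 * P $ 1 $ 2"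
  proof -
    have p: "P $ 1 $ 1 = 3 * P $ 1 $ 2 - P $ 2 $ 2"
      using trP by (simp add: trace_def sum_2)
    have "(P ** R) $ 1 $ 2 = P $ 1 $ 1 * R $ 1 $ 2 + P $ 1 $ 2 * R $ 2 $ 2"
      by (simp add: sum_2 matrix_matrix_mult_def)
    then show ?thesis
      unfolding p c d by algebra
  qed
  \<comment> \<open>For the triple (a, 3a^2, a) the terms 9a^4 cancel in the Markov
    equation.\<close>
  have "2 * (P $ 1 $ 2)\<^sup>2 = 0"
    using GM unfolding GM_triple_def b c by algebra
  with pos show False by simp
qed

lemma trace_zero_unique:
  fixes Y Y' P R :: "int^2^2"
  assumes indep: "(P $ 1 $ 1 - P $ 2 $ 2) * R $ 1 $ 2 \<noteq> (R $ 1 $ 1 - R $ 2 $ 2) * P $ 1 $ 2 \<or>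
      P $ 2 $ 1 * R $ 1 $ 2 \<noteq> R $ 2 $ 1 * P $ 1 $ 2"
    and pos: "P $ 1 $ 2 \<noteq> 0"
    and Y: "trace Y = 0" "trace (P ** Y) = 0" "trace (Y ** R) = 0" "det Y = 1"
    and Y': "trace Y' = 0" "trace (P ** Y') = 0" "trace (Y' ** R) = 0" "det Y' = 1"
  shows "Y = Y' \<or> Y = - Y'"
proof -
  define p r where "p = P $ 1 $ 1 - P $ 2 $ 2" and "r = R $ 1 $ 1 - R $ 2 $ 2"
  define a c where "a = P $ 1 $ 2" and "c = R $ 1 $ 2"
  define s t where "s = P $ 2 $ 1" and "t = R $ 2 $ 1"
  define u v w where "u = Y $ 1 $ 1" and "v = Y $ 1 $ 2" and "w = Y $ 2 $ 1"
  define u' v' w' where "u' = Y' $ 1 $ 1" and "v' = Y' $ 1 $ 2" and "w' = Y' $ 2 $ 1"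
  have Y22: "Y $ 2 $ 2 = - u" "Y' $ 2 $ 2 = - u'"
    using Y(1) Y'(1) by (simp_all add: u_def u'_def trace_def sum_2)
  have lin: "p * u + a * w + s * v = 0" "r * u + c * w + t * v = 0"
    "p * u' + a * w' + s * v' = 0" "r * u' + c * w' + t * v' = 0"
    using Y(2,3) Y'(2,3) Y22
    by (simp_all add: u_def u'_def v_def v'_def w_def w'_def p_def a_def s_def r_def c_def t_def
        trace_def sum_2 matrix_matrix_mult_def algebra_simps)
  have det: "u * u + v * w = - 1" "u' * u' + v' * w' = - 1"
    using Y(4) Y'(4) Y22
    by (simp_all add: u_def u'_def v_def v'_def w_def w'_def det_2)
  have indep': "p * c - r * a \<noteq> 0 \<or> s * c - t * a \<noteq> 0"
    using indep by (simp add: p_def r_def a_def c_def s_def t_def)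
  \<comment> \<open>Eliminating \<open>w\<close> leaves one nontrivial equation, so (u, v) and (u',
    v') are proportional.\<close>
  have "(p * c - r * a) * u + (s * c - t * a) * v = 0"
    "(p * c - r * a) * u' + (s * c - t * a) * v' = 0"
    using lin by algebra+
  then have "(p * c - r * a) * (u * v' - u' * v) = 0" "(s * c - t * a) * (u * v' - u' * v) = 0"
    by algebra+
  with indep' have uv: "u * v' = u' * v"
    by auto
  have "a * (w * v' - w' * v) = 0"
    using lin uv by algebra
  with pos have wv: "w * v' = w' * v"
    by (simp add: a_def)
  have v0: "v \<noteq> 0"
  proof
    assume "v = 0"
    with det(1) show False
      using zero_le_square[of u] by simp
  qed
  \<comment> \<open>Multiply the first determinant equation by v'^2 and the second by v^2;
    proportionality makes their left sides equal.\<close>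
  have "v * v = v' * v'"
    using det uv wv by algebra
  then consider "v' = v" | "v' = - v"
    by (auto simp: square_eq_iff)
  then show ?thesis
  proof cases
    case 1
    with uv wv v0 have "u = u'" "w = w'" by auto
    with 1 Y22 have "Y = Y'"
      by (simp add: vec_eq_iff forall_2 u_def u'_def v_def v'_def w_def w'_def)
    then show ?thesis ..
  next
    case 2
    then have "v * (u + u') = 0" "v * (w + w') = 0"
      using uv wv by algebra+
    with v0 have "u = - u'" "w = - w'" by auto
    with 2 Y22 have "Y = - Y'"
      by (simp add: vec_eq_iff forall_2 u_def u'_def v_def v'_def w_def w'_def)
    then show ?thesis ..
  qed
qed

text \<open>These products are \<open>- adj2 Z\<close> and \<open>- adj2 X\<close>, whose traces are
  minus the common trace.\<close>

lemma MM_decomposition_middle_trace_zero: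
  assumes "MM_decomposition P Q R X Y Z" "trace Y = 0"
  shows "trace (P ** Y) = 0" "trace (Y ** R) = 0"
  using assms unfolding MM_decomposition_iff
  by (auto simp: matrix_mul_assoc mult_adj2 mult_adj2_cancel)
    (simp_all add: trace_def sum_2 adj2_def)

section \<open>Uniqueness up to sign for all k\<close>

lemma MM_decomposition_middle_unique:
  assumes GC: "GC_triple k P Q R"
    and 1: "MM_decomposition P Q R X\<^sub>1 Y\<^sub>1 Z\<^sub>1" and 2: "MM_decomposition P Q R X\<^sub>2 Y\<^sub>2 Z\<^sub>2"
  shows "Y\<^sub>1 = Y\<^sub>2 \<or> Y\<^sub>1 = - Y\<^sub>2"
proof -
  have d: "det P = 1" "det R = 1" and Q: "Q = P ** R - S_mat k"
    using GC by (auto simp: GC_triple_def GC_matrix_def SL2Z_def)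
  have t: "(trace Y\<^sub>1)\<^sup>2 = k\<^sup>2" "(trace Y\<^sub>2)\<^sup>2 = k\<^sup>2"
    using MM_decomposition_trace_sq[OF _ d Q] 1 2 by blast+
  show ?thesis
  proof (cases "k = 0")
    case False
    have eq: "trace Y\<^sub>1 * Y\<^sub>1 $ i $ j = trace Y\<^sub>2 * Y\<^sub>2 $ i $ j" for i j
      using MM_decomposition_middle[OF 1] MM_decomposition_middle[OF 2] by (metis mat_mult2)
    have nz: "trace Y\<^sub>2 \<noteq> 0"
      using t False by auto
    consider "trace Y\<^sub>1 = trace Y\<^sub>2" | "trace Y\<^sub>1 = - trace Y\<^sub>2"
      using t by (metis power2_eq_iff)
    then show ?thesis
    proof cases
      case 1
      with eq nz have "Y\<^sub>1 = Y\<^sub>2" by (simp add: vec_eq_iff)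
      then show ?thesis ..
    next
      case 2
      have "trace Y\<^sub>2 * (Y\<^sub>1 $ i $ j + Y\<^sub>2 $ i $ j) = 0" for i j
        using eq[of i j] unfolding 2 by algebra
      with nz have "Y\<^sub>1 $ i $ j = - Y\<^sub>2 $ i $ j" for i j
        by (simp add: eq_neg_iff_add_eq_0)
      then have "Y\<^sub>1 = - Y\<^sub>2" by (simp add: vec_eq_iff)
      then show ?thesis ..
    qed
  next
    \<comment> \<open>Here \<open>S_mat k\<close> vanishes, so the identity for the middle matrix
      only says 0 = 0.\<close>
    case True
    have Q': "Q = P ** R"
      using Q True by (simp add: mat2_simps)
    have GM: "GM_triple 0 (P $ 1 $ 2) ((P ** R) $ 1 $ 2) (R $ 1 $ 2)"
      using GC True Q' by (simp add: GC_triple_def)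
    have "trace P = 3 * P $ 1 $ 2" "trace R = 3 * R $ 1 $ 2"
      using GC True by (auto simp: GC_triple_def GC_matrix_def)
    note indep = markov_pair_independent[OF d this GM]
    have pos: "P $ 1 $ 2 \<noteq> 0"
      using GM by (simp add: GM_triple_def)
    have t0: "trace Y\<^sub>1 = 0" "trace Y\<^sub>2 = 0"
      using t True by auto
    have "det Y\<^sub>1 = 1" "det Y\<^sub>2 = 1"
      using 1 2 by (auto simp: MM_decomposition_iff)
    with trace_zero_unique[OF indep pos] t0 show ?thesis
      using MM_decomposition_middle_trace_zero[OF 1 t0(1)]
        MM_decomposition_middle_trace_zero[OF 2 t0(2)] by blast
  qed
qed

theorem theorem5p22:
  fixes k :: int and P Q R :: "int^2^2"
  assumes "k \<ge> 0"
    and "GC_triple k P Q R"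
    and "Q $ 1 $ 2 > max (P $ 1 $ 2) (R $ 1 $ 2)"
  shows "(\<exists>X Y Z. MM_decomposition P Q R X Y Z) \<and>
    (\<forall>X\<^sub>1 Y\<^sub>1 Z\<^sub>1 X\<^sub>2 Y\<^sub>2 Z\<^sub>2.
       MM_decomposition P Q R X\<^sub>1 Y\<^sub>1 Z\<^sub>1 \<longrightarrow> MM_decomposition P Q R X\<^sub>2 Y\<^sub>2 Z\<^sub>2 \<longrightarrow>
       (X\<^sub>1, Y\<^sub>1, Z\<^sub>1) = (X\<^sub>2, Y\<^sub>2, Z\<^sub>2) \<or> (X\<^sub>1, Y\<^sub>1, Z\<^sub>1) = (- X\<^sub>2, - Y\<^sub>2, - Z\<^sub>2))"
proof (intro conjI allI impI)
  show "\<exists>X Y Z. MM_decomposition P Q R X Y Z"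
    using MM_decomposition_exists[of P R Q k] assms(2)
    unfolding GC_triple_def GC_matrix_def SL2Z_def by blast
next
  fix X\<^sub>1 Y\<^sub>1 Z\<^sub>1 X\<^sub>2 Y\<^sub>2 Z\<^sub>2
  assume 1: "MM_decomposition P Q R X\<^sub>1 Y\<^sub>1 Z\<^sub>1" and 2: "MM_decomposition P Q R X\<^sub>2 Y\<^sub>2 Z\<^sub>2"
  show "(X\<^sub>1, Y\<^sub>1, Z\<^sub>1) = (X\<^sub>2, Y\<^sub>2, Z\<^sub>2) \<or> (X\<^sub>1, Y\<^sub>1, Z\<^sub>1) = (- X\<^sub>2, - Y\<^sub>2, - Z\<^sub>2)"
    \<comment> \<open>\<open>X\<close> and \<open>Z\<close> depend linearly on
      \<open>adj2 Y\<close>, so they take the same sign as \<open>Y\<close>.\<close>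
    using MM_decomposition_middle_unique[OF assms(2) 1 2]
      MM_decomposition_determined_by_middle[OF 1] MM_decomposition_determined_by_middle[OF 2]
    by auto
qed

end
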